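(* Let $c>0$, let the complex plane $\mathbb{C}$ be equipped with the norm $\|a+bi\|=\sqrt{a^2+b^2}$ ($a,b\in\mathbb{R}$), and let $\mathbb{C}_c=\{z\in\mathbb{C} : \|z\|<c\}$. Let $\oplus_{\mathbb{C}_c}$ and $\odot_{\mathbb{C}_c}$ be the operations on $\mathbb{C}_c$ obtained by transporting the addition and the multiplication of $\mathbb{C}$ along the bijection $\phi:\mathbb{C}\to\mathbb{C}_c$, $\phi(u)=\frac{c\tanh\|u\|}{\|u\|}u$ for $u\neq0$, $\phi(0)=0$; that is, $u\oplus_{\mathbb{C}_c}v=\phi(\phi^{-1}(u)+\phi^{-1}(v))$ and $u\odot_{\mathbb{C}_c}v=\phi(\phi^{-1}(u)\cdot\phi^{-1}(v))$. Then for all $u,v\in\mathbb{C}_c$ $$u\oplus_{\mathbb{C}_c}v=c\tanh\bigl(\|A(u,v)\|\bigr)\frac{A(u,v)}{\|A(u,v)\|},\qquad A(u,v)=\operatorname{atanh}\!\left(\frac{\|u\|}{c}\right)\frac{u}{\|u\|}+\operatorname{atanh}\!\left(\frac{\|v\|}{c}\right)\frac{v}{\|v\|},$$ and $$u\odot_{\mathbb{C}_c}v=c\tanh\bigl(\|M(u,v)\|\bigr)\frac{M(u,v)}{\|M(u,v)\|},\qquad M(u,v)=\operatorname{atanh}\!\left(\frac{\|u\|}{c}\right)\frac{u}{\|u\|}\cdot\operatorname{atanh}\!\left(\frac{\|v\|}{c}\right)\frac{v}{\|v\|}.$$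
   Context: Conventions at zero: the expression $\operatorname{atanh}(\|u\|/c)\,u/\|u\|$ is understood to be $0$ when $u=0$, and $c\tanh(\|w\|)\,w/\|w\|$ is understood to be $0$ when $w=0$. Here $\operatorname{atanh}:(-1,1)\to\mathbb{R}$ is the inverse of $\tanh$. *)

theory Defs
  imports "HOL-Analysis.Analysis"
begin

definition disc :: "real \<Rightarrow> complex set" where
  "disc c = {z. norm z < c}"

definition phi :: "real \<Rightarrow> complex \<Rightarrow> complex" where
  "phi c u = (if u = 0 then 0 else (c * tanh (norm u) / norm u) *\<^sub>R u)"

text \<open>
  Together with \<open>artanh_tanh_real\<close> this shows that the library's logarithmic \<^const>\<open>artanh\<close>
  is the inverse of \<^const>\<open>tanh\<close> on the open interval from \<open>-1\<close> to \<open>1\<close>.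
  Since \<open>inverse 0 = 0\<close>, both \<open>artanh (norm u / c) *\<^sub>R (u /\<^sub>R norm u)\<close> at
  \<open>u = 0\<close> and \<open>(c * tanh (norm w)) *\<^sub>R (w /\<^sub>R norm w)\<close> at \<open>w = 0\<close> are \<open>0\<close>,
  as the convention for these expressions requires.
\<close>

lemma tanh_artanh_real:
  fixes x :: real
  assumes "-1 < x" "x < 1"
  shows "tanh (artanh x) = x"
proof -
  have "exp (- 2 * artanh x) = (1 - x) / (1 + x)"
    using assms by (simp add: artanh_def exp_minus)
  then show ?thesis
    unfolding tanh_real_altdef using assms by (simp only:) (simp add: divide_simps)
qed

lemma norm_phi:
  assumes "c > 0"
  shows "norm (phi c u) = c * tanh (norm u)"
  using assms by (simp add: phi_def)

lemma bij_betw_phi: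
  assumes c: "c > 0"
  shows "bij_betw (phi c) UNIV (disc c)"
  unfolding bij_betw_def
proof
  show "inj (phi c)"
  proof (rule injI)
    fix x y assume eq: "phi c x = phi c y"
    have "c * tanh (norm x) = c * tanh (norm y)"
      using norm_phi[OF c, of x] norm_phi[OF c, of y] unfolding eq by (rule trans[OF sym])
    then have n: "norm x = norm y" using c by simp
    show "x = y"
    proof (cases "x = 0")
      case True
      then show ?thesis using n by simp
    next
      case False
      then have "y \<noteq> 0" using n by auto
      then show ?thesis using eq False c n by (simp add: phi_def)
    qed
  qed
  show "range (phi c) = disc c"
  proof
    have "norm (phi c x) < c" for x
    proof -
      have "c * tanh (norm x) < c * 1"
        using c tanh_real_lt_1[of "norm x"] by (intro mult_strict_left_mono) auto
      then show ?thesis by (simp add: norm_phi[OF c])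
    qed
    then show "range (phi c) \<subseteq> disc c" by (auto simp: disc_def)
  next
    show "disc c \<subseteq> range (phi c)"
    proof
      fix z assume "z \<in> disc c"
      then have z: "norm z < c" by (simp add: disc_def)
      show "z \<in> range (phi c)"
      proof (cases "z = 0")
        case True
        then have "z = phi c 0" by (simp add: phi_def)
        then show ?thesis by blast
      next
        case False
        have lt: "norm z / c < 1" "0 < norm z / c" using z c False by auto
        define t where "t = artanh (norm z / c)"
        have th: "tanh t = norm z / c"
          unfolding t_def using lt by (intro tanh_artanh_real) auto
        then have t: "t > 0" using lt by (metis tanh_real_pos_iff)
        define w where "w = (t / norm z) *\<^sub>R z"
        have "norm w = t" using False t by (simp add: w_def)
        then have "phi c w = (c * tanh t / t) *\<^sub>R w" using t by (auto simp: phi_def)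
        also have "\<dots> = z" using th t c False by (simp add: w_def)
        finally show ?thesis by (metis rangeI)
      qed
    qed
  qed
qed

text \<open>
  The operations are transported along \<^term>\<open>phi c\<close>. They are only meaningful on
  \<^term>\<open>disc c\<close> with \<open>c > 0\<close>, where \<^term>\<open>inv (phi c)\<close> is the
  two-sided inverse by \<open>bij_betw_phi\<close>.
\<close>

definition plus_disc :: "real \<Rightarrow> complex \<Rightarrow> complex \<Rightarrow> complex" where
  "plus_disc c u v = phi c (inv (phi c) u + inv (phi c) v)"

definition times_disc :: "real \<Rightarrow> complex \<Rightarrow> complex \<Rightarrow> complex" where
  "times_disc c u v = phi c (inv (phi c) u * inv (phi c) v)"

end

theory Submission
  imports Defs
begin

text \<open>The map \<open>phi c\<close> is radial: it keeps directions and sends length r to c tanh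
  r. Its inverse on the disc therefore keeps directions and sends length s to
  \<open>artanh (s / c)\<close>, which is \<open>inv_phi_eq\<close>. Both operations apply
  \<open>phi c\<close> to a sum or product of preimages, so substituting this inverse and the form
  \<open>phi_eq\<close> gives both formulas. The origin fits in because
  \<open>inverse 0 = 0\<close>.\<close>

lemma phi_eq: "phi c w = (c * tanh (norm w)) *\<^sub>R (w /\<^sub>R norm w)"
  by (simp add: phi_def divide_inverse)

text \<open>Gives an explicit left inverse of \<open>phi c\<close>, by recovering direction and
  length separately.\<close>

lemma artanh_norm_phi:
  assumes "c > 0"
  shows "artanh (norm (phi c w) / c) *\<^sub>R (phi c w /\<^sub>R norm (phi c w)) = w"
proof (cases "w = 0")
  case True
  then show ?thesis by (simp add: phi_def)
next
  case False
  \<comment> \<open>Normalizing cancels the positive factor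
    \<open>c * tanh (norm w) / norm w\<close>.\<close>
  have "phi c w /\<^sub>R norm (phi c w) = w /\<^sub>R norm w"
    unfolding norm_phi[OF assms] using False assms by (simp add: phi_def divide_simps)
  moreover have "artanh (norm (phi c w) / c) = norm w"
    using assms by (simp add: norm_phi artanh_tanh_real)
  ultimately show ?thesis using False by simp
qed

text \<open>Surjectivity onto the disc makes u the image of \<open>inv (phi c) u\<close>; the
  explicit left inverse then recovers that preimage from u.\<close>

lemma inv_phi_eq:
  assumes "c > 0" "u \<in> disc c"
  shows "inv (phi c) u = artanh (norm u / c) *\<^sub>R (u /\<^sub>R norm u)"
proof -
  have "phi c (inv (phi c) u) = u"
    using bij_betw_phi[OF assms(1)] assms(2) by (simp add: bij_betw_def f_inv_into_f)
  then show ?thesis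
    using artanh_norm_phi[OF assms(1), of "inv (phi c) u"] by simp
qed

theorem theorem4p2:
  fixes c :: real
  assumes "c > 0"
  shows "\<forall>u \<in> disc c. \<forall>v \<in> disc c.
    plus_disc c u v =
      (let A = artanh (norm u / c) *\<^sub>R (u /\<^sub>R norm u) + artanh (norm v / c) *\<^sub>R (v /\<^sub>R norm v)
       in (c * tanh (norm A)) *\<^sub>R (A /\<^sub>R norm A)) \<and>
    times_disc c u v =
      (let M = (artanh (norm u / c) *\<^sub>R (u /\<^sub>R norm u)) * (artanh (norm v / c) *\<^sub>R (v /\<^sub>R norm v))
       in (c * tanh (norm M)) *\<^sub>R (M /\<^sub>R norm M))"
proof (intro ballI)
  fix u v
  assume "u \<in> disc c" "v \<in> disc c"
  then show "plus_disc c u v =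
      (let A = artanh (norm u / c) *\<^sub>R (u /\<^sub>R norm u) + artanh (norm v / c) *\<^sub>R (v /\<^sub>R norm v)
       in (c * tanh (norm A)) *\<^sub>R (A /\<^sub>R norm A)) \<and>
    times_disc c u v =
      (let M = (artanh (norm u / c) *\<^sub>R (u /\<^sub>R norm u)) * (artanh (norm v / c) *\<^sub>R (v /\<^sub>R norm v))
       in (c * tanh (norm M)) *\<^sub>R (M /\<^sub>R norm M))"
    unfolding plus_disc_def times_disc_def Let_def
    \<comment> \<open>\<open>phi_eq\<close> matches only the outer, fully applied
      \<open>phi c\<close>; the one inside \<open>inv (phi c)\<close> is left to
      \<open>inv_phi_eq\<close>.\<close>
    by (simp only: inv_phi_eq[OF assms] phi_eq simp_thms)
qed

end
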